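(* Let $x:[t_0,t_\mathrm{f}]\to\mathbb{R}$ be a solution of the ODE $\frac{\mathrm{d}}{\mathrm{d}t}x(t)=f(x(t),t)$, let $\tau(t)=\int_{t_0}^{t}\sqrt{1+\left(\frac{\mathrm{d}}{\mathrm{d}s}x(s)\right)^2}\,\mathrm{d}s$, $t\in[t_0,t_\mathrm{f}]$, be the arc length of the curve $[t,\ x(t)]^\top$, let $\tau^{-1}:[0,\tau(t_\mathrm{f})]\to[t_0,t_\mathrm{f}]$ be its inverse, and let $\sigma:[0,1]\to[0,\tau(t_\mathrm{f})]$ be strictly monotonically increasing. Define $\tilde{\tau}^{-1}:=\tau^{-1}\circ\sigma$ and $\tilde{x}:=x\circ\tilde{\tau}^{-1}$ on $[0,1]$. If $x\in C^\nu$ and $\sigma\in C^\mu$, then $\tilde{x}\in C^{\min(\nu,\mu)}$ and $\tilde{\tau}^{-1}\in C^{\min(\nu,\mu)}$.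
   Context: $C^k$ denotes $k$ times continuously differentiable functions (on the respective closed interval), with $\infty$ allowed as an exponent. As $x$ is an ODE solution, it is differentiable on $[t_0,t_\mathrm{f}]$ and the arc length integral defining $\tau$ is assumed well defined. The function $\tilde{x}$ is called the reparameterized solution and $\tilde{\tau}^{-1}$ the reparameterization. *)

theory Defs
  imports "HOL-Analysis.Analysis" "HOL-Library.Extended_Nat"
begin

text \<open>Derivatives are taken within \<open>S\<close>, so they are one-sided at the endpoints of a closed interval.\<close>

primrec cont_diff_nat_on :: "nat \<Rightarrow> real set \<Rightarrow> (real \<Rightarrow> real) \<Rightarrow> bool" where
  "cont_diff_nat_on 0 S f \<longleftrightarrow> continuous_on S f"
| "cont_diff_nat_on (Suc k) S f \<longleftrightarrow>
     (\<exists>f'. (\<forall>t\<in>S. (f has_real_derivative f' t) (at t within S)) \<and> cont_diff_nat_on k S f')"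

text \<open>The class \<open>C\<^sup>k\<close> on \<open>S\<close>; \<open>k = \<infinity>\<close> gives \<open>C\<^sup>n\<close> for all finite \<open>n\<close>. For finite \<open>k\<close> the
  quantification over \<open>n \<le> k\<close> is harmless, because \<open>C\<^sup>k\<close> implies \<open>C\<^sup>n\<close>.\<close>

definition cont_diff_on :: "enat \<Rightarrow> real set \<Rightarrow> (real \<Rightarrow> real) \<Rightarrow> bool" where
  "cont_diff_on k S f \<longleftrightarrow> (\<forall>n. enat n \<le> k \<longrightarrow> cont_diff_nat_on n S f)"

definition ode_solution ::
    "(real \<Rightarrow> real \<Rightarrow> real) \<Rightarrow> real \<Rightarrow> real \<Rightarrow> (real \<Rightarrow> real) \<Rightarrow> bool" where
  "ode_solution f t0 tf x \<longleftrightarrow>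
     (\<forall>t\<in>{t0..tf}. (x has_real_derivative f (x t) t) (at t within {t0..tf}))"

definition arc_speed :: "real \<Rightarrow> real \<Rightarrow> (real \<Rightarrow> real) \<Rightarrow> real \<Rightarrow> real" where
  "arc_speed t0 tf x s = sqrt (1 + (vector_derivative x (at s within {t0..tf}))\<^sup>2)"

text \<open>The integral is the Henstock--Kurzweil one; since the integrand is nonnegative, it exists
  exactly when the Lebesgue integral does.\<close>

definition arc_length :: "real \<Rightarrow> real \<Rightarrow> (real \<Rightarrow> real) \<Rightarrow> real \<Rightarrow> real" where
  "arc_length t0 tf x t = integral {t0..t} (arc_speed t0 tf x)"

definition arc_length_inv :: "real \<Rightarrow> real \<Rightarrow> (real \<Rightarrow> real) \<Rightarrow> real \<Rightarrow> real" where
  "arc_length_inv t0 tf x = inv_into {t0..tf} (arc_length t0 tf x)"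

definition reparameterization ::
    "real \<Rightarrow> real \<Rightarrow> (real \<Rightarrow> real) \<Rightarrow> (real \<Rightarrow> real) \<Rightarrow> real \<Rightarrow> real" where
  "reparameterization t0 tf x \<sigma> = arc_length_inv t0 tf x \<circ> \<sigma>"

definition reparameterized_solution ::
    "real \<Rightarrow> real \<Rightarrow> (real \<Rightarrow> real) \<Rightarrow> (real \<Rightarrow> real) \<Rightarrow> real \<Rightarrow> real" where
  "reparameterized_solution t0 tf x \<sigma> = x \<circ> reparameterization t0 tf x \<sigma>"

end

theory Submission
  imports Defs
begin

text \<open>The arc length \<open>\<tau>\<close> grows at least as fast as \<open>t\<close>, because its integrand is at least 1. Hence
  it is a homeomorphism onto \<open>[0, \<tau>(t\<^sub>f)]\<close>, which settles the case of exponent 0. If \<open>x\<close> is at least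
  \<open>C\<^sup>1\<close>, the inverse \<open>g = \<tau>\<inverse>\<close> satisfies \<open>g' = w \<circ> x' \<circ> g\<close> with the smooth function
  \<open>w(u) = 1 / \<surd>(1 + u\<^sup>2)\<close>, and this equation raises the regularity of \<open>g\<close> step by step up to that
  of \<open>x\<close>. The claim follows since \<open>C\<^sup>n\<close> is closed under composition.\<close>

section \<open>Closure properties of the class C^n\<close>

lemma cont_diff_nat_on_SucI:
  assumes "\<And>t. t \<in> S \<Longrightarrow> (f has_real_derivative f' t) (at t within S)"
    and "cont_diff_nat_on k S f'"
  shows "cont_diff_nat_on (Suc k) S f"
  unfolding cont_diff_nat_on.simps using assms by blast

lemma cont_diff_nat_on_continuous:
  "cont_diff_nat_on n S f \<Longrightarrow> continuous_on S f"
  by (cases n) (auto intro: DERIV_continuous_on)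

lemma cont_diff_nat_on_SucD:
  "cont_diff_nat_on (Suc n) S f \<Longrightarrow> cont_diff_nat_on n S f"
proof (induction n arbitrary: f)
  case 0
  then show ?case by (auto intro: DERIV_continuous_on)
next
  case (Suc n)
  then show ?case by (metis cont_diff_nat_on.simps(2))
qed

lemma cont_diff_nat_on_const: "cont_diff_nat_on n S (\<lambda>_. c)"
proof (induction n arbitrary: c)
  case (Suc n)
  show ?case unfolding cont_diff_nat_on.simps
    by (rule exI[of _ "\<lambda>_. 0"]) (use Suc in auto)
qed auto

lemma cont_diff_nat_on_ident: "cont_diff_nat_on n S (\<lambda>t. t)"
proof (cases n)
  case (Suc k)
  show ?thesis unfolding Suc cont_diff_nat_on.simps
    by (rule exI[of _ "\<lambda>_. 1"]) (auto intro: cont_diff_nat_on_const)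
qed auto

lemma cont_diff_nat_on_add:
  "cont_diff_nat_on n S f \<Longrightarrow> cont_diff_nat_on n S g \<Longrightarrow> cont_diff_nat_on n S (\<lambda>t. f t + g t)"
proof (induction n arbitrary: f g)
  case 0
  then show ?case by (auto intro: continuous_on_add)
next
  case (Suc n)
  obtain f' g' where
    "\<forall>t\<in>S. (f has_real_derivative f' t) (at t within S)" "cont_diff_nat_on n S f'"
    "\<forall>t\<in>S. (g has_real_derivative g' t) (at t within S)" "cont_diff_nat_on n S g'"
    using Suc.prems by auto
  then show ?case unfolding cont_diff_nat_on.simps
    by (intro exI[of _ "\<lambda>t. f' t + g' t"]) (auto intro: Suc.IH DERIV_add)
qed

lemma cont_diff_nat_on_mult:
  "cont_diff_nat_on n S f \<Longrightarrow> cont_diff_nat_on n S g \<Longrightarrow> cont_diff_nat_on n S (\<lambda>t. f t * g t)"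
proof (induction n arbitrary: f g)
  case 0
  then show ?case by (auto intro: continuous_on_mult)
next
  case (Suc n)
  obtain f' g' where
    "\<forall>t\<in>S. (f has_real_derivative f' t) (at t within S)" "cont_diff_nat_on n S f'"
    "\<forall>t\<in>S. (g has_real_derivative g' t) (at t within S)" "cont_diff_nat_on n S g'"
    using Suc.prems by auto
  then show ?case unfolding cont_diff_nat_on.simps
    by (intro exI[of _ "\<lambda>t. f t * g' t + f' t * g t"])
      (auto intro!: Suc.IH DERIV_mult' cont_diff_nat_on_add
        intro: cont_diff_nat_on_SucD[OF Suc.prems(1)] cont_diff_nat_on_SucD[OF Suc.prems(2)])
qed

text \<open>The chain rule gives the derivative \<open>f' (g t) * g' t\<close>. Its first factor
  falls under the induction hypothesis once \<open>g\<close> is demoted by one order, and C^n is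
  closed under products.\<close>

lemma cont_diff_nat_on_compose:
  "cont_diff_nat_on n T f \<Longrightarrow> cont_diff_nat_on n S g \<Longrightarrow> g ` S \<subseteq> T
    \<Longrightarrow> cont_diff_nat_on n S (\<lambda>t. f (g t))"
proof (induction n arbitrary: f g)
  case 0
  then show ?case by (auto intro: continuous_on_compose2)
next
  case (Suc n)
  obtain f' g' where
    f': "\<forall>t\<in>T. (f has_real_derivative f' t) (at t within T)" "cont_diff_nat_on n T f'" and
    g': "\<forall>t\<in>S. (g has_real_derivative g' t) (at t within S)" "cont_diff_nat_on n S g'"
    using Suc.prems by auto
  have "((\<lambda>t. f (g t)) has_real_derivative f' (g t) * g' t) (at t within S)" if "t \<in> S" for t
  proof -
    \<comment> \<open>The chain rule for one-sided derivatives wants \<open>f\<close> differentiated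
      within the image of \<open>S\<close>, so the derivative within \<open>T\<close> is restricted
      to it.\<close>
    have "(f has_real_derivative f' (g t)) (at (g t) within g ` S)"
      using f'(1) that Suc.prems(3) by (blast intro: DERIV_subset)
    from DERIV_image_chain[OF this bspec[OF g'(1) that]] show ?thesis by (simp add: o_def)
  qed
  moreover have "cont_diff_nat_on n S (\<lambda>t. f' (g t) * g' t)"
    using Suc.IH[OF f'(2) cont_diff_nat_on_SucD[OF Suc.prems(2)] Suc.prems(3)] g'(2)
    by (rule cont_diff_nat_on_mult)
  ultimately show ?case by (rule cont_diff_nat_on_SucI)
qed

text \<open>The function satisfies w' = - u w^3. The right-hand side is a polynomial in u and w, so
  if w is C^n, then so is w'.\<close>

lemma cont_diff_nat_on_inverse_sqrt: "cont_diff_nat_on n UNIV (\<lambda>u. 1 / sqrt (1 + u\<^sup>2))"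
proof (induction n)
  case 0
  show ?case
    by (auto intro!: continuous_intros simp: add_nonneg_eq_0_iff)
next
  case (Suc n)
  define w where "w = (\<lambda>u::real. 1 / sqrt (1 + u\<^sup>2))"
  \<comment> \<open>The derivative is spelled out as a product of a constant, the identity and
    copies of \<open>w\<close>, so that the closure rules apply to it directly.\<close>
  have "(w has_real_derivative (-1 * u) * (w u * (w u * w u))) (at u)" for u
  proof -
    have pos: "1 + u\<^sup>2 > 0" by (simp add: add_pos_nonneg)
    have "((\<lambda>u. 1 / sqrt (1 + u\<^sup>2)) has_real_derivative
        - (inverse (sqrt (1 + u\<^sup>2)) / 2 * (2 * u)) / (sqrt (1 + u\<^sup>2) * sqrt (1 + u\<^sup>2))) (at u)"
      using pos by (auto intro!: derivative_eq_intros)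
    then show ?thesis unfolding w_def by (rule DERIV_cong) (use pos in \<open>simp add: field_simps\<close>)
  qed
  moreover have "cont_diff_nat_on n UNIV (\<lambda>u. (-1 * u) * (w u * (w u * w u)))"
    using Suc unfolding w_def
    by (intro cont_diff_nat_on_mult cont_diff_nat_on_const cont_diff_nat_on_ident)
  ultimately have "cont_diff_nat_on (Suc n) UNIV w"
    by (rule cont_diff_nat_on_SucI)
  then show ?case unfolding w_def .
qed

section \<open>Regularity from an autonomous equation, and derivatives of inverses\<close>

text \<open>Bootstrapping: as long as \<open>h\<close> is smooth enough, \<open>g\<close> of class
  C^k makes the derivative \<open>h (g y)\<close> of class C^k, hence \<open>g\<close> of class
  C^(k+1). The start is the continuity of \<open>g\<close>, and the process ends one order above
  that of \<open>h\<close>.\<close>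

lemma cont_diff_nat_on_autonomous:
  assumes "\<And>y. y \<in> T \<Longrightarrow> (g has_real_derivative h (g y)) (at y within T)"
    and "g ` T \<subseteq> S" and "cont_diff_nat_on n S h"
  shows "cont_diff_nat_on (Suc n) T g"
  using assms(3)
proof (induction n)
  case 0
  have "continuous_on T g" using assms(1) by (rule DERIV_continuous_on)
  then have "continuous_on T (\<lambda>y. h (g y))"
    using 0 assms(2) by (auto intro: continuous_on_compose2)
  then show ?case by (intro cont_diff_nat_on_SucI[OF assms(1)]) auto
next
  case (Suc n)
  have "cont_diff_nat_on (Suc n) T g" by (rule Suc.IH[OF cont_diff_nat_on_SucD[OF Suc.prems]])
  then have "cont_diff_nat_on (Suc n) T (\<lambda>y. h (g y))"
    using cont_diff_nat_on_compose[OF Suc.prems] assms(2) by blast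
  with assms(1) show ?case by (rule cont_diff_nat_on_SucI)
qed

text \<open>Since \<open>f (g z) = z\<close>, the difference quotient of \<open>g\<close> at
  \<open>y\<close> is the reciprocal of that of \<open>f\<close> at \<open>g y\<close>, and
  continuity of \<open>g\<close> carries the limit over. Limits within \<open>S\<close> and
  \<open>T\<close> cover the endpoints of intervals.\<close>

lemma has_field_derivative_inverse_within:
  fixes f g :: "'a::real_normed_field \<Rightarrow> 'a"
  assumes f: "(f has_field_derivative D) (at (g y) within S)" and "D \<noteq> 0"
    and "y \<in> T" and g: "continuous_on T g" "g ` T \<subseteq> S" and fg: "\<And>z. z \<in> T \<Longrightarrow> f (g z) = z"
  shows "(g has_field_derivative inverse D) (at y within T)"
proof -
  have ev: "\<forall>\<^sub>F z in at y within T. z \<in> T \<and> z \<noteq> y"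
    by (auto simp: eventually_at_filter)
  \<comment> \<open>Substituting \<open>g z\<close> into the limit defining \<open>D\<close>
    requires \<open>g z\<close> to differ from \<open>g y\<close>; this holds because
    \<open>f\<close> maps the two to the distinct points \<open>z\<close> and
    \<open>y\<close>.\<close>
  have "filterlim g (at (g y) within S) (at y within T)"
    unfolding filterlim_at
  proof
    show "\<forall>\<^sub>F z in at y within T. g z \<in> S \<and> g z \<noteq> g y"
      using ev by eventually_elim (use assms in \<open>metis image_subset_iff\<close>)
    show "(g \<longlongrightarrow> g y) (at y within T)"
      using g \<open>y \<in> T\<close> by (auto simp: continuous_on)
  qed
  with f have "((\<lambda>z. (f (g z) - f (g y)) / (g z - g y)) \<longlongrightarrow> D) (at y within T)"
    unfolding has_field_derivative_iff by (rule filterlim_compose)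
  then have "((\<lambda>z. inverse ((f (g z) - f (g y)) / (g z - g y))) \<longlongrightarrow> inverse D) (at y within T)"
    using \<open>D \<noteq> 0\<close> by (rule tendsto_inverse)
  moreover have "\<forall>\<^sub>F z in at y within T.
      inverse ((f (g z) - f (g y)) / (g z - g y)) = (g z - g y) / (z - y)"
    using ev by eventually_elim (use fg \<open>y \<in> T\<close> in simp)
  ultimately show ?thesis
    unfolding has_field_derivative_iff by (rule Lim_transform_eventually)
qed

section \<open>Arc length and its inverse\<close>

text \<open>Comparing the speed with the constant 1 uses its integrability only, so the bound is
  available for exponent 0, where the derivative of \<open>x\<close> may be discontinuous.\<close>

lemma arc_length_growth:
  assumes int: "arc_speed t0 tf x integrable_on {t0..tf}"
    and "t0 \<le> s" "s \<le> t" "t \<le> tf"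
  shows "t - s \<le> arc_length t0 tf x t - arc_length t0 tf x s"
proof -
  have sub: "arc_speed t0 tf x integrable_on {a..b}" if "t0 \<le> a" "b \<le> tf" for a b
    using int that by (auto intro: integrable_subinterval_real)
  have "integral {s..t} (\<lambda>_. 1) \<le> integral {s..t} (arc_speed t0 tf x)"
    using assms by (intro integral_le sub) (auto simp: arc_speed_def)
  moreover have "arc_length t0 tf x s + integral {s..t} (arc_speed t0 tf x) = arc_length t0 tf x t"
    unfolding arc_length_def using assms by (intro Henstock_Kurzweil_Integration.integral_combine sub) auto
  ultimately show ?thesis using \<open>s \<le> t\<close> by simp
qed

lemma inj_on_arc_length:
  assumes "arc_speed t0 tf x integrable_on {t0..tf}"
  shows "inj_on (arc_length t0 tf x) {t0..tf}"
proof (rule linorder_inj_onI)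
  fix s t assume "s < t" "s \<in> {t0..tf}" "t \<in> {t0..tf}"
  then show "arc_length t0 tf x s \<noteq> arc_length t0 tf x t"
    using arc_length_growth[OF assms, of s t] by auto
qed auto

lemma arc_length_continuous:
  assumes "arc_speed t0 tf x integrable_on {t0..tf}"
  shows "continuous_on {t0..tf} (arc_length t0 tf x)"
  using indefinite_integral_continuous_1[OF assms] by (simp add: arc_length_def[abs_def])

lemma arc_length_surj:
  assumes "t0 \<le> tf" and "arc_speed t0 tf x integrable_on {t0..tf}"
  shows "{0..arc_length t0 tf x tf} \<subseteq> arc_length t0 tf x ` {t0..tf}"
proof
  fix y assume "y \<in> {0..arc_length t0 tf x tf}"
  moreover have "arc_length t0 tf x t0 = 0" by (simp add: arc_length_def)
  ultimately show "y \<in> arc_length t0 tf x ` {t0..tf}"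
    using IVT'[of "arc_length t0 tf x" t0 y tf] arc_length_continuous[OF assms(2)] assms(1)
    by auto
qed

text \<open>The intermediate value theorem puts every point of the interval into the range of the
  arc length. The inverse is continuous because the arc length is a continuous injection on a
  compact interval.\<close>

lemma arc_length_inv:
  assumes "t0 \<le> tf" and "arc_speed t0 tf x integrable_on {t0..tf}"
  shows "arc_length_inv t0 tf x ` {0..arc_length t0 tf x tf} \<subseteq> {t0..tf}"
    and "\<And>y. y \<in> {0..arc_length t0 tf x tf}
      \<Longrightarrow> arc_length t0 tf x (arc_length_inv t0 tf x y) = y"
    and "continuous_on {0..arc_length t0 tf x tf} (arc_length_inv t0 tf x)"
proof -
  note surj = arc_length_surj[OF assms]
  show "arc_length_inv t0 tf x ` {0..arc_length t0 tf x tf} \<subseteq> {t0..tf}"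
    unfolding arc_length_inv_def by (rule image_subsetI) (rule inv_into_into[OF subsetD[OF surj]])
  show "arc_length t0 tf x (arc_length_inv t0 tf x y) = y"
    if "y \<in> {0..arc_length t0 tf x tf}" for y
    unfolding arc_length_inv_def by (rule f_inv_into_f[OF subsetD[OF surj that]])
  have "continuous_on (arc_length t0 tf x ` {t0..tf}) (arc_length_inv t0 tf x)"
    unfolding arc_length_inv_def
    using continuous_on_inv[OF arc_length_continuous[OF assms(2)] compact_Icc]
      inj_on_arc_length[OF assms(2)] by simp
  then show "continuous_on {0..arc_length t0 tf x tf} (arc_length_inv t0 tf x)"
    using surj by (rule continuous_on_subset)
qed

lemma cont_diff_nat_on_arc_length_inv:
  assumes "t0 < tf" and int: "arc_speed t0 tf x integrable_on {t0..tf}"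
    and "cont_diff_nat_on n {t0..tf} x"
  shows "cont_diff_nat_on n {0..arc_length t0 tf x tf} (arc_length_inv t0 tf x)"
proof (cases n)
  case 0
  then show ?thesis using arc_length_inv(3) assms by simp
next
  case (Suc k)
  obtain x' where x': "\<forall>t\<in>{t0..tf}. (x has_real_derivative x' t) (at t within {t0..tf})"
      "cont_diff_nat_on k {t0..tf} x'"
    using assms(3) unfolding Suc by auto
  \<comment> \<open>As \<open>t0 < tf\<close>, derivatives within the interval are unique, so the
    speed can be expressed by the chosen derivative \<open>x'\<close>.\<close>
  have speed: "arc_speed t0 tf x t = sqrt (1 + (x' t)\<^sup>2)" if "t \<in> {t0..tf}" for t
    unfolding arc_speed_def
    using vector_derivative_within_closed_interval[OF \<open>t0 < tf\<close> that, of x "x' t"] bspec[OF x'(1) that]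
    by (simp add: has_real_derivative_iff_has_vector_derivative)
  have "continuous_on {t0..tf} (\<lambda>t. sqrt (1 + (x' t)\<^sup>2))"
    by (intro continuous_intros cont_diff_nat_on_continuous[OF x'(2)])
  then have cont: "continuous_on {t0..tf} (arc_speed t0 tf x)"
    by (rule continuous_on_eq) (simp add: speed)
  \<comment> \<open>With a continuous speed the fundamental theorem of calculus applies, endpoints
    included.\<close>
  have arc': "(arc_length t0 tf x has_real_derivative sqrt (1 + (x' t)\<^sup>2)) (at t within {t0..tf})"
    if "t \<in> {t0..tf}" for t
    using integral_has_real_derivative[OF cont that] speed[OF that]
    by (simp add: arc_length_def[abs_def])
  let ?T = "{0..arc_length t0 tf x tf}" and ?g = "arc_length_inv t0 tf x"
  note inv = arc_length_inv[OF less_imp_le[OF \<open>t0 < tf\<close>] int]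
  have "(?g has_real_derivative 1 / sqrt (1 + (x' (?g y))\<^sup>2)) (at y within ?T)" if "y \<in> ?T" for y
  proof -
    have "?g y \<in> {t0..tf}" using inv(1) that by blast
    moreover have "sqrt (1 + (x' (?g y))\<^sup>2) \<noteq> 0" by (simp add: add_nonneg_eq_0_iff)
    ultimately show ?thesis
      using has_field_derivative_inverse_within[OF arc' _ that inv(3,1,2)]
      by (simp add: inverse_eq_divide)
  qed
  \<comment> \<open>The derivative of the inverse is this function evaluated at the inverse itself.
    It is only C^k, like \<open>x'\<close>; the autonomous equation regains the lost order.\<close>
  moreover have "cont_diff_nat_on k {t0..tf} (\<lambda>t. 1 / sqrt (1 + (x' t)\<^sup>2))"
    using cont_diff_nat_on_compose[OF cont_diff_nat_on_inverse_sqrt x'(2)] by simp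
  ultimately show ?thesis
    unfolding Suc using inv(1) by (intro cont_diff_nat_on_autonomous)
qed

section \<open>Regularity of the reparameterized solution\<close>

theorem proposition3p1:
  fixes f :: "real \<Rightarrow> real \<Rightarrow> real"
    and x \<sigma> :: "real \<Rightarrow> real"
    and t0 tf :: real
    and \<nu> \<mu> :: enat
  assumes "t0 < tf"
    and "ode_solution f t0 tf x"
    and "arc_speed t0 tf x integrable_on {t0..tf}"
    and "\<sigma> ` {0..1} \<subseteq> {0..arc_length t0 tf x tf}"
    and "strict_mono_on {0..1} \<sigma>"
    and "cont_diff_on \<nu> {t0..tf} x"
    and "cont_diff_on \<mu> {0..1} \<sigma>"
  shows "cont_diff_on (min \<nu> \<mu>) {0..1} (reparameterized_solution t0 tf x \<sigma>)
       \<and> cont_diff_on (min \<nu> \<mu>) {0..1} (reparameterization t0 tf x \<sigma>)"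
proof -
  \<comment> \<open>Arguing for each finite order below the minimum treats finite and infinite
    exponents alike: \<open>x\<close> and \<open>\<sigma>\<close> are then both of class
    C^n.\<close>
  have "cont_diff_nat_on n {0..1} (reparameterized_solution t0 tf x \<sigma>)
      \<and> cont_diff_nat_on n {0..1} (reparameterization t0 tf x \<sigma>)"
    if "enat n \<le> min \<nu> \<mu>" for n
  proof -
    have x: "cont_diff_nat_on n {t0..tf} x" and \<sigma>: "cont_diff_nat_on n {0..1} \<sigma>"
      using that assms(6,7) by (auto simp: cont_diff_on_def)
    have "cont_diff_nat_on n {0..1} (reparameterization t0 tf x \<sigma>)"
      unfolding reparameterization_def o_def
      using cont_diff_nat_on_arc_length_inv[OF assms(1,3) x] \<sigma> assms(4)
      by (rule cont_diff_nat_on_compose)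
    moreover have "reparameterization t0 tf x \<sigma> ` {0..1} \<subseteq> {t0..tf}"
      using arc_length_inv(1)[OF less_imp_le[OF assms(1)] assms(3)] assms(4)
      unfolding reparameterization_def o_def by blast
    ultimately show ?thesis
      unfolding reparameterized_solution_def o_def
      using cont_diff_nat_on_compose[OF x] by blast
  qed
  then show ?thesis by (simp add: cont_diff_on_def)
qed

end
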